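(* Every countable graph is majority $3$-choosable: for every countable (simple) graph $G$ and every assignment of lists $L(v)$, each consisting of exactly $3$ colours, to the vertices $v\in V(G)$, there is a majority colouring $\chi$ of $G$ with $\chi(v)\in L(v)$ for every $v\in V(G)$.
   Context: A majority colouring of a graph $G$ is an assignment $\chi$ of colours to the vertices such that for every vertex $v$: if $v$ has finite degree, at most half of the edges incident with $v$ are monochromatic (i.e. join $v$ to a neighbour $u$ with $\chi(u)=\chi(v)$); if $v$ has infinite degree, the set of non-monochromatic edges at $v$ has the same cardinality as the whole neighbourhood of $v$ (for a countable graph: $v$ has infinitely many neighbours $u$ with $\chi(u)\neq\chi(v)$). A graph is majority $\ell$-choosable if for every system of lists $(L(v))_{v\in V(G)}$ with $|L(v)|=\ell$ there is a majority colouring $\chi$ with $\chi(v)\in L(v)$ for all $v$. *)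

theory Defs
  imports "HOL-Library.Countable_Set" "HOL-Library.Equipollence"
begin

definition simple_graph :: "'a set \<Rightarrow> 'a set set \<Rightarrow> bool" where
  "simple_graph V E \<longleftrightarrow> (\<forall>e\<in>E. e \<subseteq> V \<and> card e = 2)"

definition neighbourhood :: "'a set set \<Rightarrow> 'a \<Rightarrow> 'a set" where
  "neighbourhood E v = {u. {v, u} \<in> E}"

definition incident_edges :: "'a set set \<Rightarrow> 'a \<Rightarrow> 'a set set" where
  "incident_edges E v = {e \<in> E. v \<in> e}"

definition monochromatic :: "('a \<Rightarrow> 'c) \<Rightarrow> 'a set \<Rightarrow> bool" where
  "monochromatic \<chi> e \<longleftrightarrow> (\<forall>u\<in>e. \<forall>w\<in>e. \<chi> u = \<chi> w)"

definition majority_colouring :: "'a set \<Rightarrow> 'a set set \<Rightarrow> ('a \<Rightarrow> 'c) \<Rightarrow> bool" where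
  "majority_colouring V E \<chi> \<longleftrightarrow>
     (\<forall>v\<in>V.
        if finite (incident_edges E v)
        then 2 * card {e \<in> incident_edges E v. monochromatic \<chi> e} \<le> card (incident_edges E v)
        else {e \<in> incident_edges E v. \<not> monochromatic \<chi> e} \<approx> neighbourhood E v)"

text \<open>
  The colours are drawn from an arbitrary type, which does not occur in the graph and is therefore
  passed as an explicit type argument. Finiteness of the lists is only relevant for
  \<open>l = 0\<close>, since infinite sets have \<open>card\<close> zero.
\<close>

definition majority_choosable :: "'c itself \<Rightarrow> nat \<Rightarrow> 'a set \<Rightarrow> 'a set set \<Rightarrow> bool" where
  "majority_choosable (_ :: 'c itself) l V E \<longleftrightarrow>
     (\<forall>L :: 'a \<Rightarrow> 'c set. (\<forall>v\<in>V. finite (L v) \<and> card (L v) = l) \<longrightarrow>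
        (\<exists>\<chi>. majority_colouring V E \<chi> \<and> (\<forall>v\<in>V. \<chi> v \<in> L v)))"

end

theory Submission
  imports Defs "HOL-Library.Diagonal_Subsequence" "HOL-Library.Nat_Bijection"
begin

text \<open>
  Enumerate the vertices. Each vertex \<open>v\<close> of infinite degree claims infinitely many of its later
  neighbours, no vertex being claimed twice. Recursively along the enumeration, choose
  \<open>\<psi> u \<in> L u\<close> different from the value \<open>\<psi> v\<close> at the claimant \<open>v\<close> of \<open>u\<close>. Vertices of infinite degree
  receive colour \<open>\<psi>\<close>, and a vertex of finite degree is only forbidden the colour of its claimant, so
  that every vertex of infinite degree is satisfied whatever happens next. As at least two colours
  remain for each vertex of finite degree, these can be satisfied too: finitely many of them by
  minimising the number of monochromatic edges, and all of them by compactness.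
\<close>

section \<open>Countable sets: disjoint infinite claims and pointwise limits\<close>

lemma exists_inj_choice_infinite:
  fixes A :: "nat \<Rightarrow> 'a set"
  assumes "\<And>k. infinite (A k)"
  obtains g where "inj g" "\<And>k. g k \<in> A k"
proof -
  have "\<exists>g. \<forall>k. g k \<in> A k \<and> g k \<notin> g ` {..<k}"
  proof (rule dependent_wellorder_choice)
    fix k and f :: "nat \<Rightarrow> 'a"
    have "infinite (A k - f ` {..<k})"
      using assms by (simp add: Diff_infinite_finite)
    then show "\<exists>x. x \<in> A k \<and> x \<notin> f ` {..<k}"
      using infinite_imp_nonempty by blast
  next
    fix x and f g :: "nat \<Rightarrow> 'a" and k
    assume "\<And>y. y < k \<Longrightarrow> f y = g y"
    then have "f ` {..<k} = g ` {..<k}" by auto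
    then show "(x \<in> A k \<and> x \<notin> f ` {..<k}) = (x \<in> A k \<and> x \<notin> g ` {..<k})" by simp
  qed
  then obtain g where g: "\<And>k. g k \<in> A k" "\<And>k. g k \<notin> g ` {..<k}" by blast
  have "inj g"
  proof (rule linorder_injI)
    show "g i \<noteq> g j" if "i < j" for i j
      using g(2)[of j] that by (metis imageI lessThan_iff)
  qed
  from this g(1) show thesis by (rule that)
qed

text \<open>A single injective choice along an enumeration that visits each \<open>v\<close>
  infinitely often gives every \<open>v\<close> infinitely many elements of \<open>A v\<close>.
  Since \<open>p\<close> is a function, no element is claimed twice.\<close>

lemma exists_infinite_fibres:
  fixes A :: "'b \<Rightarrow> 'a set"
  assumes "countable I" and inf: "\<And>v. v \<in> I \<Longrightarrow> infinite (A v)"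
  obtains p where "\<And>v. v \<in> I \<Longrightarrow> infinite {u \<in> A v. p u = v}"
proof (cases "I = {}")
  case True
  then show thesis using that by blast
next
  case False
  \<comment> \<open>Keeping only the first component of the decoded pair makes \<open>h\<close> take
    each value in \<open>I\<close> at least once for every second component.\<close>
  define h where "h k = from_nat_into I (fst (prod_decode k))" for k
  have "h k \<in> I" for k
    using False by (simp add: h_def from_nat_into)
  then obtain g where g: "inj g" "\<And>k. g k \<in> A (h k)"
    using exists_inj_choice_infinite[of "\<lambda>k. A (h k)"] inf by blast
  show thesis
  \<comment> \<open>Off the range of \<open>g\<close> the value of \<open>inv g\<close> is
    arbitrary; this can only enlarge the fibres.\<close>
  proof (rule that[of "\<lambda>u. h (inv g u)"])
    fix v assume v: "v \<in> I"
    let ?f = "\<lambda>n. g (prod_encode (to_nat_on I v, n))"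
    have h: "h (prod_encode (to_nat_on I v, n)) = v" for n
      using v \<open>countable I\<close> by (simp add: h_def)
    have "inj ?f"
      by (rule injI) (simp add: inj_eq[OF g(1)])
    then have "infinite (range ?f)"
      by (simp add: finite_image_iff)
    moreover have "range ?f \<subseteq> {u \<in> A v. h (inv g u) = v}"
    proof (rule image_subsetI)
      fix n
      show "?f n \<in> {u \<in> A v. h (inv g u) = v}"
        using g(2)[of "prod_encode (to_nat_on I v, n)"] g(1) by (simp add: h)
    qed
    ultimately show "infinite {u \<in> A v. h (inv g u) = v}"
      using finite_subset by blast
  qed
qed

text \<open>Sequential compactness of a countable product of finite sets: the pigeonhole principle
  makes the values at one vertex constant along a subsequence, and diagonalisation treats all
  vertices together.\<close>

lemma exists_pointwise_limit_subsequence: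
  fixes X :: "nat \<Rightarrow> 'a \<Rightarrow> 'c"
  assumes "countable V"
    and fin: "\<And>v. v \<in> V \<Longrightarrow> finite (M v)"
    and X: "\<And>n v. v \<in> V \<Longrightarrow> X n v \<in> M v"
  obtains d :: "nat \<Rightarrow> nat" and \<chi>
  where "strict_mono d" "\<And>v. v \<in> V \<Longrightarrow> \<forall>\<^sub>F n in sequentially. X (d n) v = \<chi> v"
proof -
  \<comment> \<open>Asking for constant rather than eventually constant values makes
    \<open>P m\<close> pass to every further subsequence, as \<open>diagseq_holds\<close>
    demands.\<close>
  define P where
    "P m s \<longleftrightarrow> (\<forall>v\<in>V. to_nat_on V v = m \<longrightarrow> (\<exists>c. \<forall>k. X (s k) v = c))" for m and s :: "nat \<Rightarrow> nat"
  interpret subseqs P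
  proof
    fix m and s :: "nat \<Rightarrow> nat" assume "strict_mono s"
    show "\<exists>r. strict_mono r \<and> P m (s \<circ> r)"
    proof (cases "\<exists>v\<in>V. to_nat_on V v = m")
      case True
      then obtain v where v: "v \<in> V" "to_nat_on V v = m" by blast
      have "finite (range (\<lambda>k. X (s k) v))"
        by (rule finite_subset[OF _ fin[OF v(1)]]) (use X v in auto)
      then obtain c where c: "infinite {k. X (s k) v = c}"
        using pigeonhole_infinite[of UNIV "\<lambda>k. X (s k) v"] by auto
      then obtain r :: "nat \<Rightarrow> nat" where r: "strict_mono r" "\<And>k. r k \<in> {k. X (s k) v = c}"
        using infinite_enumerate by blast
      have "w = v" if "w \<in> V" "to_nat_on V w = m" for w
        using that v to_nat_on_inj[OF \<open>countable V\<close>, of w v] by simp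
      then have "P m (s \<circ> r)"
        using r by (auto simp: P_def)
      with r show ?thesis by blast
    next
      case False
      then have "P m (s \<circ> id)" by (simp add: P_def)
      then show ?thesis using strict_mono_id by blast
    qed
  qed
  have "\<exists>c. \<forall>\<^sub>F n in sequentially. X (diagseq n) v = c" if v: "v \<in> V" for v
  proof -
    let ?m = "to_nat_on V v"
    have "P ?m (diagseq \<circ> (+) (Suc ?m))"
      by (rule diagseq_holds) (auto simp: P_def)
    then obtain c where "\<And>k. X (diagseq (Suc ?m + k)) v = c"
      using v by (auto simp: P_def)
    then have "\<forall>n\<ge>Suc ?m. X (diagseq n) v = c"
      by (metis le_add_diff_inverse)
    then show ?thesis
      unfolding eventually_sequentially by blast
  qed
  then obtain \<chi> where "\<And>v. v \<in> V \<Longrightarrow> \<forall>\<^sub>F n in sequentially. X (diagseq n) v = \<chi> v"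
    by metis
  with subseq_diagseq show thesis by (rule that)
qed

section \<open>Counting edges at a vertex through its neighbours\<close>

lemma countable_infinite_eqpoll:
  assumes "countable A" "infinite A" "countable B" "infinite B"
  shows "A \<approx> B"
proof -
  have "A \<approx> (UNIV :: nat set)" "B \<approx> (UNIV :: nat set)"
    using to_nat_on_infinite assms eqpoll_def by blast+
  then show ?thesis
    using eqpoll_trans eqpoll_sym by blast
qed

lemma incident_edges_eq_image:
  assumes "simple_graph V E"
  shows "incident_edges E v = (\<lambda>u. {v, u}) ` neighbourhood E v"
proof -
  have "e \<in> (\<lambda>u. {v, u}) ` neighbourhood E v" if "e \<in> E" "v \<in> e" for e
  proof -
    have "card e = 2" using assms that by (simp add: simple_graph_def)
    then obtain x where "e = {v, x}"
      using \<open>v \<in> e\<close> by (auto simp: card_2_iff)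
    with that show ?thesis by (auto simp: neighbourhood_def)
  qed
  then show ?thesis
    by (auto simp: incident_edges_def neighbourhood_def)
qed

lemma neighbourhood_subset:
  assumes "simple_graph V E"
  shows "neighbourhood E v \<subseteq> V"
  using assms by (auto simp: simple_graph_def neighbourhood_def)

lemma not_self_neighbour:
  assumes "simple_graph V E"
  shows "v \<notin> neighbourhood E v"
  using assms by (auto simp: simple_graph_def neighbourhood_def)

lemma inj_doubleton: "inj (\<lambda>u. {v, u})"
  by (auto simp: inj_def doubleton_eq_iff)

lemma monochromatic_doubleton [simp]: "monochromatic \<chi> {v, u} \<longleftrightarrow> \<chi> u = \<chi> v"
  by (auto simp: monochromatic_def)

lemma monochromatic_cong:
  assumes "\<And>u. u \<in> e \<Longrightarrow> \<chi> u = \<chi>' u"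
  shows "monochromatic \<chi> e \<longleftrightarrow> monochromatic \<chi>' e"
  using assms by (auto simp: monochromatic_def)

section \<open>Satisfying the vertices of finite degree\<close>

definition satisfied :: "'a set set \<Rightarrow> ('a \<Rightarrow> 'c) \<Rightarrow> 'a \<Rightarrow> bool" where
  "satisfied E \<chi> v \<longleftrightarrow>
     2 * card {e \<in> incident_edges E v. monochromatic \<chi> e} \<le> card (incident_edges E v)"

text \<open>Minimise the number of monochromatic edges that meet \<open>T\<close>. Changing the
  colour of one \<open>v\<close> in \<open>T\<close> cannot lower the count at \<open>v\<close>, and
  no edge at \<open>v\<close> is monochromatic both before and after, so the count before is at most
  half the degree. Vertices outside \<open>T\<close> may have a single colour available, which
  allows their colours to be prescribed.\<close>

lemma exists_colouring_satisfied_finite: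
  fixes M :: "'a \<Rightarrow> 'c set"
  assumes graph: "simple_graph V E"
    and T: "finite T" "T \<subseteq> V" "\<And>v. v \<in> T \<Longrightarrow> finite (incident_edges E v)"
    and ne: "\<And>v. v \<in> V \<Longrightarrow> M v \<noteq> {}"
    and two: "\<And>v c. v \<in> T \<Longrightarrow> \<exists>c'\<in>M v. c' \<noteq> c"
  obtains \<chi> where "\<And>v. v \<in> V \<Longrightarrow> \<chi> v \<in> M v" "\<And>v. v \<in> T \<Longrightarrow> satisfied E \<chi> v"
proof -
  define B where "B = (\<Union>v\<in>T. incident_edges E v)"
  have finB: "finite B" using T by (auto simp: B_def)
  define energy where "energy \<chi> = card {e \<in> B. monochromatic \<chi> e}" for \<chi> :: "'a \<Rightarrow> 'c"
  obtain \<chi>0 where "\<forall>v\<in>V. \<chi>0 v \<in> M v"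
    using ne bchoice[of V "\<lambda>v c. c \<in> M v"] by blast
  then obtain \<chi> where \<chi>: "\<forall>v\<in>V. \<chi> v \<in> M v"
    and min: "\<And>\<chi>'. \<forall>v\<in>V. \<chi>' v \<in> M v \<Longrightarrow> energy \<chi> \<le> energy \<chi>'"
    using ex_has_least_nat[of "\<lambda>\<chi>. \<forall>v\<in>V. \<chi> v \<in> M v" \<chi>0 energy] by blast
  have "satisfied E \<chi> v" if v: "v \<in> T" for v
  proof -
    let ?I = "incident_edges E v"
    let ?mono = "\<lambda>\<chi>. {e \<in> ?I. monochromatic \<chi> e}"
    obtain c where c: "c \<in> M v" "c \<noteq> \<chi> v" using two v by blast
    define \<chi>' where "\<chi>' = \<chi>(v := c)"
    have finI: "finite ?I" using T v by blast
    \<comment> \<open>All edges at \<open>v\<close> lie in \<open>B\<close> because \<open>v\<close>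
      is in \<open>T\<close>; the second summand does not depend on the colour of
      \<open>v\<close>.\<close>
    have energy: "energy \<phi> = card (?mono \<phi>) + card {e \<in> B. v \<notin> e \<and> monochromatic \<phi> e}"
      for \<phi> :: "'a \<Rightarrow> 'c"
    proof -
      have "{e \<in> B. monochromatic \<phi> e} = ?mono \<phi> \<union> {e \<in> B. v \<notin> e \<and> monochromatic \<phi> e}"
        using v by (auto simp: B_def incident_edges_def)
      moreover have "?mono \<phi> \<inter> {e \<in> B. v \<notin> e \<and> monochromatic \<phi> e} = {}"
        by (auto simp: incident_edges_def)
      ultimately show ?thesis
        unfolding energy_def using finI finB by (simp add: card_Un_disjoint)
    qed
    have "monochromatic \<chi>' e \<longleftrightarrow> monochromatic \<chi> e" if "v \<notin> e" for e
      using that by (intro monochromatic_cong) (auto simp: \<chi>'_def)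
    then have "{e \<in> B. v \<notin> e \<and> monochromatic \<chi>' e} = {e \<in> B. v \<notin> e \<and> monochromatic \<chi> e}"
      by blast
    moreover have "energy \<chi> \<le> energy \<chi>'"
      by (rule min) (use \<chi> c in \<open>auto simp: \<chi>'_def\<close>)
    ultimately have "card (?mono \<chi>) \<le> card (?mono \<chi>')"
      by (simp add: energy)
    moreover have "card (?mono \<chi>) + card (?mono \<chi>') \<le> card ?I"
    proof -
      \<comment> \<open>The other end has colour \<open>\<chi> v\<close> and keeps it, while
        \<open>v\<close> moves to \<open>c\<close>.\<close>
      have "\<not> monochromatic \<chi>' e" if "e \<in> ?I" "monochromatic \<chi> e" for e
      proof -
        obtain u where "e = {v, u}" "u \<in> neighbourhood E v"
          using \<open>e \<in> ?I\<close> by (auto simp: incident_edges_eq_image[OF graph])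
        moreover from this have "u \<noteq> v"
          using not_self_neighbour[OF graph] by blast
        ultimately show ?thesis
          using \<open>monochromatic \<chi> e\<close> c by (simp add: \<chi>'_def)
      qed
      then have "?mono \<chi> \<inter> ?mono \<chi>' = {}" by blast
      then have "card (?mono \<chi>) + card (?mono \<chi>') = card (?mono \<chi> \<union> ?mono \<chi>')"
        using finI by (simp add: card_Un_disjoint)
      also have "\<dots> \<le> card ?I"
        by (rule card_mono) (use finI in auto)
      finally show ?thesis .
    qed
    ultimately show ?thesis by (simp add: satisfied_def)
  qed
  with \<chi> show thesis using that by blast
qed

text \<open>Whether a vertex of finite degree is satisfied depends on finitely many colours, so the
  property survives the pointwise limit of colourings that satisfy larger and larger finite sets
  \<open>T n\<close>.\<close>

lemma exists_colouring_satisfied: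
  fixes M :: "'a \<Rightarrow> 'c set"
  assumes graph: "simple_graph V E" and "countable V"
    and fin: "\<And>v. v \<in> V \<Longrightarrow> finite (M v)"
    and ne: "\<And>v. v \<in> V \<Longrightarrow> M v \<noteq> {}"
    and two: "\<And>v c. v \<in> V \<Longrightarrow> finite (incident_edges E v) \<Longrightarrow> \<exists>c'\<in>M v. c' \<noteq> c"
  obtains \<chi> where "\<And>v. v \<in> V \<Longrightarrow> \<chi> v \<in> M v"
    "\<And>v. v \<in> V \<Longrightarrow> finite (incident_edges E v) \<Longrightarrow> satisfied E \<chi> v"
proof -
  define T where "T n = {v \<in> V. finite (incident_edges E v) \<and> to_nat_on V v < n}" for n
  have finT: "finite (T n)" for n
  proof (rule inj_on_finite[of _ _ "{..<n}"])
    show "inj_on (to_nat_on V) (T n)"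
      by (rule inj_on_subset[OF inj_on_to_nat_on[OF \<open>countable V\<close>]]) (auto simp: T_def)
  qed (auto simp: T_def)
  have "\<exists>\<chi>. (\<forall>v\<in>V. \<chi> v \<in> M v) \<and> (\<forall>v\<in>T n. satisfied E \<chi> v)" for n
  proof (rule exists_colouring_satisfied_finite[OF graph finT, of n M])
    show "\<exists>c'\<in>M v. c' \<noteq> c" if "v \<in> T n" for v c
      using that two by (simp add: T_def)
  qed (use ne in \<open>auto simp: T_def\<close>)
  then obtain X where X: "\<And>n v. v \<in> V \<Longrightarrow> X n v \<in> M v" "\<And>n v. v \<in> T n \<Longrightarrow> satisfied E (X n) v"
    by metis
  obtain d \<chi> where d: "strict_mono d"
    and lim: "\<And>v. v \<in> V \<Longrightarrow> \<forall>\<^sub>F n in sequentially. X (d n) v = \<chi> v"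
    using exists_pointwise_limit_subsequence[of V M X, OF \<open>countable V\<close> fin X(1)] by blast
  show thesis
  proof (rule that)
    fix v assume v: "v \<in> V"
    obtain n where "X (d n) v = \<chi> v"
      using eventually_happens[OF lim[OF v]] by auto
    with X(1)[OF v] show "\<chi> v \<in> M v" by metis
  next
    fix v assume v: "v \<in> V" "finite (incident_edges E v)"
    let ?W = "\<Union> (incident_edges E v)"
    have "?W \<subseteq> V"
      using graph by (auto simp: incident_edges_def simple_graph_def)
    moreover have "finite ?W"
      using v(2) by (rule finite_Union) (auto simp: incident_edges_eq_image[OF graph])
    ultimately have W: "?W \<subseteq> V" "finite ?W" .
    have "\<forall>\<^sub>F n in sequentially. \<forall>u\<in>?W. X (d n) u = \<chi> u"
      by (rule eventually_ball_finite) (use W lim in auto)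
    moreover have "\<forall>\<^sub>F n in sequentially. to_nat_on V v < n"
      by (rule eventually_gt_at_top)
    ultimately have "\<forall>\<^sub>F n in sequentially. (\<forall>u\<in>?W. X (d n) u = \<chi> u) \<and> to_nat_on V v < n"
      by (rule eventually_conj)
    from eventually_happens[OF this]
    obtain n where n: "\<forall>u\<in>?W. X (d n) u = \<chi> u" "to_nat_on V v < n"
      by (simp del: Union_iff) blast
    \<comment> \<open>A strictly increasing \<open>d\<close> has \<open>n \<le> d n\<close>, so
      \<open>v\<close> already belongs to \<open>T (d n)\<close>.\<close>
    have "to_nat_on V v < d n"
      using n(2) seq_suble[OF d, of n] by simp
    then have "satisfied E (X (d n)) v"
      using v by (intro X(2)) (simp add: T_def)
    moreover have "{e \<in> incident_edges E v. monochromatic (X (d n)) e} =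
        {e \<in> incident_edges E v. monochromatic \<chi> e}"
      by (intro Collect_cong conj_cong refl monochromatic_cong) (use n(1) in blast)
    ultimately show "satisfied E \<chi> v" by (simp add: satisfied_def)
  qed
qed

section \<open>Vertices of infinite degree and the final colouring\<close>

lemma exists_choice_avoiding_parent:
  fixes L :: "'a \<Rightarrow> 'c set" and r :: "'a \<Rightarrow> nat"
  assumes "\<And>u c. u \<in> V \<Longrightarrow> \<exists>c'\<in>L u. c' \<noteq> c"
  obtains \<psi> where "\<And>u. u \<in> V \<Longrightarrow> \<psi> u \<in> L u"
    "\<And>u. u \<in> V \<Longrightarrow> r (p u) < r u \<Longrightarrow> \<psi> u \<noteq> \<psi> (p u)"
proof -
  have "\<exists>\<psi>. \<forall>u. u \<in> V \<longrightarrow> \<psi> u \<in> L u \<and> (r (p u) < r u \<longrightarrow> \<psi> u \<noteq> \<psi> (p u))"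
  \<comment> \<open>The colour at \<open>u\<close> is constrained only by \<open>p u\<close>, and
    only when \<open>p u\<close> has smaller rank, so the recursion is well-founded and one colour
    to avoid is all that arises.\<close>
  proof (rule dependent_wf_choice[of "measure r"])
    fix u and f :: "'a \<Rightarrow> 'c"
    show "\<exists>c. u \<in> V \<longrightarrow> c \<in> L u \<and> (r (p u) < r u \<longrightarrow> c \<noteq> f (p u))"
      using assms by blast
  qed auto
  then show thesis using that by blast
qed

theorem theorem5:
  fixes V :: "'a set" and E :: "'a set set"
  assumes "simple_graph V E"
    and "countable V"
  shows "majority_choosable TYPE('c) 3 V E"
  unfolding majority_choosable_def
proof (intro allI impI)
  fix L :: "'a \<Rightarrow> 'c set"
  assume L: "\<forall>v\<in>V. finite (L v) \<and> card (L v) = 3"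
  let ?inf = "\<lambda>v. infinite (incident_edges E v)"
  let ?N = "neighbourhood E"
  define r where "r = to_nat_on V"
  have inj_r: "inj_on r V"
    using assms by (simp add: r_def inj_on_to_nat_on)
  have N_infinite: "infinite (?N v)" if "?inf v" for v
    using that by (auto simp: incident_edges_eq_image[OF assms(1)])
  \<comment> \<open>Only finitely many vertices have rank at most \<open>r v\<close>. Claims are
    restricted to later neighbours so that the claimant has its \<open>\<psi>\<close> colour
    first.\<close>
  have "infinite {u \<in> ?N v. r v < r u}" if "?inf v" for v
  proof
    assume "finite {u \<in> ?N v. r v < r u}"
    moreover have "finite {u \<in> V. r u \<le> r v}"
      by (rule inj_on_finite[of r _ "{..r v}"]) (auto intro: inj_on_subset[OF inj_r])
    ultimately have "finite ({u \<in> ?N v. r v < r u} \<union> {u \<in> V. r u \<le> r v})" by simp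
    moreover have "?N v \<subseteq> {u \<in> ?N v. r v < r u} \<union> {u \<in> V. r u \<le> r v}"
      using neighbourhood_subset[OF assms(1), of v] by auto
    ultimately show False
      using N_infinite[OF that] finite_subset by blast
  qed
  moreover have "countable {v \<in> V. ?inf v}"
    using assms(2) by simp
  ultimately obtain p where
    "\<And>v. v \<in> {v \<in> V. ?inf v} \<Longrightarrow> infinite {u \<in> {u \<in> ?N v. r v < r u}. p u = v}"
    using exists_infinite_fibres[of "{v \<in> V. ?inf v}" "\<lambda>v. {u \<in> ?N v. r v < r u}"] by blast
  then have p: "infinite {u \<in> {u \<in> ?N v. r v < r u}. p u = v}" if "v \<in> V" "?inf v" for v
    using that by blast
  have L3: "\<exists>c'\<in>L v. c' \<noteq> c1 \<and> c' \<noteq> c2" if "v \<in> V" for v c1 c2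
  proof (rule ccontr)
    assume "\<not> ?thesis"
    then have "L v \<subseteq> {c1, c2}" by blast
    then have "card (L v) \<le> card {c1, c2}" by (intro card_mono) auto
    also have "\<dots> \<le> 2" by (simp add: card_insert_if)
    finally show False using L that by simp
  qed
  have "\<exists>c'\<in>L v. c' \<noteq> c" if "v \<in> V" for v c
    using L3[OF that] by blast
  then obtain \<psi> where \<psi>: "\<And>u. u \<in> V \<Longrightarrow> \<psi> u \<in> L u"
    "\<And>u. u \<in> V \<Longrightarrow> r (p u) < r u \<Longrightarrow> \<psi> u \<noteq> \<psi> (p u)"
    using exists_choice_avoiding_parent[of V L r p] by blast
  \<comment> \<open>Infinite degree freezes the colour \<open>\<psi> v\<close>. At finite degree one
    colour at most is lost, even where \<open>p v\<close> is an arbitrary value because nobody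
    claimed \<open>v\<close>; hence two of the three remain.\<close>
  define M where "M v = (if ?inf v then {\<psi> v} else L v - {\<psi> (p v)})" for v
  obtain \<chi> where \<chi>: "\<And>v. v \<in> V \<Longrightarrow> \<chi> v \<in> M v"
    "\<And>v. v \<in> V \<Longrightarrow> finite (incident_edges E v) \<Longrightarrow> satisfied E \<chi> v"
  proof (rule exists_colouring_satisfied[OF assms, of M])
    show "finite (M v)" if "v \<in> V" for v
      using L that by (simp add: M_def)
    show "M v \<noteq> {}" if "v \<in> V" for v
      using L3[OF that, of "\<psi> (p v)" "\<psi> (p v)"] by (auto simp: M_def)
    show "\<exists>c'\<in>M v. c' \<noteq> c" if "v \<in> V" "finite (incident_edges E v)" for v c
      using L3[OF that(1), of "\<psi> (p v)" c] that(2) by (auto simp: M_def)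
  qed blast
  have "{e \<in> incident_edges E v. \<not> monochromatic \<chi> e} \<approx> ?N v" if v: "v \<in> V" "?inf v" for v
  proof -
    have "\<chi> u \<noteq> \<chi> v" if u: "u \<in> ?N v" "r v < r u" "p u = v" for u
    proof -
      have "u \<in> V" using u neighbourhood_subset[OF assms(1)] by blast
      \<comment> \<open>If \<open>u\<close> has infinite degree, \<open>\<chi> u\<close> is
        \<open>\<psi> u\<close>, which avoids \<open>\<psi> (p u)\<close> by the rank condition;
        otherwise \<open>\<psi> (p u)\<close> was removed from \<open>M u\<close>.\<close>
      then have "\<chi> u \<noteq> \<psi> v"
        using \<chi>(1)[of u] \<psi>(2)[of u] u by (auto simp: M_def split: if_splits)
      moreover have "\<chi> v = \<psi> v"
        using \<chi>(1)[of v] v by (simp add: M_def)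
      ultimately show ?thesis by simp
    qed
    then have "{u \<in> {u \<in> ?N v. r v < r u}. p u = v} \<subseteq> {u \<in> ?N v. \<chi> u \<noteq> \<chi> v}" by blast
    then have "infinite {u \<in> ?N v. \<chi> u \<noteq> \<chi> v}"
      using p[OF v] finite_subset by blast
    moreover have cN: "countable (?N v)"
      using neighbourhood_subset[OF assms(1)] assms(2) countable_subset by blast
    moreover have "countable {u \<in> ?N v. \<chi> u \<noteq> \<chi> v}"
      using cN by (simp add: countable_Collect)
    ultimately have "{u \<in> ?N v. \<chi> u \<noteq> \<chi> v} \<approx> ?N v"
      using N_infinite[OF v(2)] by (intro countable_infinite_eqpoll)
    moreover have "{e \<in> incident_edges E v. \<not> monochromatic \<chi> e} =
        (\<lambda>u. {v, u}) ` {u \<in> ?N v. \<chi> u \<noteq> \<chi> v}"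
      by (auto simp: incident_edges_eq_image[OF assms(1)])
    moreover have "(\<lambda>u. {v, u}) ` {u \<in> ?N v. \<chi> u \<noteq> \<chi> v} \<approx> {u \<in> ?N v. \<chi> u \<noteq> \<chi> v}"
      by (intro inj_on_image_eqpoll_self inj_on_subset[OF inj_doubleton]) auto
    ultimately show ?thesis by (simp add: eqpoll_trans)
  qed
  then have "majority_colouring V E \<chi>"
    using \<chi>(2) by (simp add: majority_colouring_def satisfied_def)
  moreover have "\<chi> v \<in> L v" if "v \<in> V" for v
    using \<chi>(1)[OF that] \<psi>(1)[OF that] by (auto simp: M_def split: if_splits)
  ultimately show "\<exists>\<chi>. majority_colouring V E \<chi> \<and> (\<forall>v\<in>V. \<chi> v \<in> L v)" by blast
qed

end
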